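(* Let $n,k,a,b$ be admissible integers, i.e. integers with $n \geq k \geq 0$, $a > b > 0$, $\gcd(a,b)=1$, and either $n-k<a-b$ or $k<b$. Let $q \in \mathbb{C}\setminus\{0\}$ and define \[ h_q(x) \coloneqq \sum_{j\geq 0} \genfrac{[}{]}{0pt}{}{n+aj}{k+bj}_q x^j \in \mathbb{C}[[x]]. \] Then $h_q(x)$ is D-finite if and only if $q$ is a root of unity.
   Context: For integers $0\le k\le N$, the $q$-binomial coefficient is $\genfrac{[}{]}{0pt}{}{N}{k}_q \coloneqq \frac{[N]_q!}{[k]_q!\,[N-k]_q!}$, where $[m]_q! \coloneqq \prod_{i=1}^{m}(1+q+\cdots+q^{i-1})$; it is a polynomial in $q$, evaluated here at the complex number $q$. A power series $f(x)\in\mathbb{C}[[x]]$ is D-finite if it satisfies a linear differential equation $p_m(x) f^{(m)}(x)+\cdots+p_0(x)f(x)=0$ with polynomial coefficients $p_i\in\mathbb{C}[x]$ not all zero. *)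

theory Defs
  imports Complex_Main "HOL-Computational_Algebra.Computational_Algebra"
begin

definition q_int :: "nat \<Rightarrow> complex poly" where
  "q_int m = (\<Sum>l<m. monom 1 l)"

definition q_fact :: "nat \<Rightarrow> complex poly" where
  "q_fact m = (\<Prod>i=1..m. q_int i)"

text \<open>The quotient is formed in the polynomial ring, before evaluation: at a root of unity the
  evaluated denominator may vanish. For \<open>k \<le> N\<close> the division is exact, see \<open>q_binomial_exact\<close>.\<close>

definition q_binomial_poly :: "nat \<Rightarrow> nat \<Rightarrow> complex poly" where
  "q_binomial_poly N k = q_fact N div (q_fact k * q_fact (N - k))"

definition q_binomial :: "complex \<Rightarrow> nat \<Rightarrow> nat \<Rightarrow> complex" where
  "q_binomial q N k = poly (q_binomial_poly N k) q"

definition D_finite :: "complex fps \<Rightarrow> bool" where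
  "D_finite f \<longleftrightarrow>
     (\<exists>(m::nat) (p :: nat \<Rightarrow> complex poly).
        (\<exists>i\<le>m. p i \<noteq> 0) \<and> (\<Sum>i\<le>m. fps_of_poly (p i) * (fps_deriv ^^ i) f) = 0)"

definition root_of_unity :: "complex \<Rightarrow> bool" where
  "root_of_unity z \<longleftrightarrow> (\<exists>m>0. z ^ m = 1)"

definition admissible :: "nat \<Rightarrow> nat \<Rightarrow> nat \<Rightarrow> nat \<Rightarrow> bool" where
  "admissible n k a b \<longleftrightarrow>
     n \<ge> k \<and> a > b \<and> b > 0 \<and> gcd a b = 1 \<and> (n - k < a - b \<or> k < b)"

definition h_series :: "nat \<Rightarrow> nat \<Rightarrow> nat \<Rightarrow> nat \<Rightarrow> complex \<Rightarrow> complex fps" where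
  "h_series n k a b q = Abs_fps (\<lambda>j. q_binomial q (n + a * j) (k + b * j))"

lemma q_fact_Suc: "q_fact (Suc m) = q_fact m * q_int (Suc m)"
  by (simp add: q_fact_def)

lemma q_int_add: "q_int (m + n) = q_int m + monom 1 m * q_int n"
proof (induction n)
  case (Suc n)
  then show ?case
    by (simp add: q_int_def distrib_left mult_monom)
qed (simp add: q_int_def)

lemma q_fact_dvd: "k \<le> N \<Longrightarrow> q_fact k * q_fact (N - k) dvd q_fact N"
proof (induction N arbitrary: k)
  case 0
  then show ?case by (simp add: q_fact_def)
next
  case (Suc N)
  show ?case
  proof (cases "k = 0 \<or> k = Suc N")
    case True
    then show ?thesis by (auto simp: q_fact_def)
  next
    case False
    then obtain l d where l: "k = Suc l" and d: "N = l + Suc d"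
      using Suc.prems by (metis less_iff_Suc_add le_neq_implies_less not0_implies_Suc
          Suc_less_eq add_Suc_right)
    have "q_fact l * q_fact (Suc d) dvd q_fact N"
      using Suc.IH[of l] d by simp
    then have 1: "q_fact k * q_fact (Suc d) dvd q_fact N * q_int k"
      using mult_dvd_mono[OF _ dvd_refl, of _ "q_fact N" "q_int k"]
      by (simp add: l q_fact_Suc mult_ac)
    have "q_fact k * q_fact d dvd q_fact N"
      using Suc.IH[of k] d l by simp
    then have 2: "q_fact k * q_fact (Suc d) dvd q_fact N * q_int (Suc d)"
      using mult_dvd_mono[OF _ dvd_refl, of _ "q_fact N" "q_int (Suc d)"]
      by (simp add: q_fact_Suc mult_ac)
    have "q_fact (Suc N) = q_fact N * q_int k + monom 1 k * (q_fact N * q_int (Suc d))"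
      using q_int_add[of k "Suc d"] by (simp add: q_fact_Suc l d algebra_simps)
    moreover have "Suc N - k = Suc d" using l d by simp
    ultimately show ?thesis using 1 2 by (simp add: dvd_add dvd_mult)
  qed
qed

lemma q_binomial_exact:
  "k \<le> N \<Longrightarrow> q_binomial_poly N k * (q_fact k * q_fact (N - k)) = q_fact N"
  by (simp add: q_binomial_poly_def q_fact_dvd)

end

theory Submission
  imports Defs
begin

text \<open>If \<open>q\<close> has order \<open>m\<close>, the \<open>q\<close>-Lucas theorem turns each section of the coefficient sequence
  along a residue class modulo \<open>m\<close> into a multiple of a hypergeometric sequence of ordinary binomial
  coefficients, and counting dimensions yields a differential equation valid for all sections at once.

  If \<open>q\<close> is not a root of unity, a differential equation becomes, after division by a common factor,
  a relation \<open>\<Sum>\<^sub>s P\<^sub>s(j) H\<^sub>s(q ^ j) = 0\<close> for all \<open>j\<close>, where \<open>P\<^sub>s\<close> collects the terms that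
  shift the index by \<open>s\<close>. As the powers of \<open>q\<close> are distinct, this is an identity of polynomials in two
  independent variables. The degree of \<open>H\<^sub>s\<close> is strictly increasing in \<open>s\<close>, so the leading
  coefficients force every \<open>P\<^sub>s\<close> to vanish.\<close>

section \<open>D-finiteness as a linear relation between coefficients\<close>

lemma fps_nth_deriv_iterate:
  fixes f :: "'a::comm_ring_1 fps"
  shows "fps_nth ((fps_deriv ^^ t) f) J = pochhammer (of_nat J + 1) t * fps_nth f (J + t)"
proof (induction t arbitrary: J)
  case (Suc t)
  then show ?case
    by (simp add: pochhammer_rec algebra_simps)
qed simp

text \<open>With \<open>f = \<Sum>\<^sub>j c\<^sub>j x ^ j\<close> and \<open>u = (l, t)\<close>: the coefficient of \<open>x ^ J\<close> in
  \<open>x ^ l\<close> times the \<open>t\<close>-th derivative of \<open>f\<close>.\<close>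

definition deriv_term :: "(nat \<Rightarrow> complex) \<Rightarrow> nat \<times> nat \<Rightarrow> nat \<Rightarrow> complex" where
  "deriv_term c u J = (if fst u \<le> J
     then pochhammer (of_nat (J - fst u) + 1) (snd u) * c (J - fst u + snd u) else 0)"

lemma fps_nth_monom_mult_deriv:
  "fps_nth (fps_of_poly (monom w l) * (fps_deriv ^^ t) f) J = w * deriv_term (fps_nth f) (l, t) J"
  by (simp add: fps_of_poly_monom mult.assoc fps_X_power_mult_nth fps_nth_deriv_iterate
      deriv_term_def not_le)

text \<open>Comparison of the coefficients of \<open>x ^ J\<close> on both sides. Each pair in
  \<open>U\<close> is one monomial of the operator; an arbitrary finite \<open>U\<close> leaves room
  for sparse sets of monomials later on.\<close>

lemma D_finite_iff_deriv_term:
  "D_finite f \<longleftrightarrow> (\<exists>U v. finite U \<and> (\<exists>u\<in>U. v u \<noteq> 0) \<and>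
      (\<forall>J. (\<Sum>u\<in>U. v u * deriv_term (fps_nth f) u J) = 0))"
proof
  assume "D_finite f"
  then obtain m p where p: "\<exists>i\<le>m. p i \<noteq> 0"
    and eq: "(\<Sum>i\<le>m. fps_of_poly (p i) * (fps_deriv ^^ i) f) = 0"
    unfolding D_finite_def by blast
  define L where "L = (\<Sum>i\<le>m. degree (p i))"
  have L: "degree (p i) \<le> L" if "i \<le> m" for i
    unfolding L_def by (rule member_le_sum) (use that in auto)
  obtain i where i: "i \<le> m" "p i \<noteq> 0" using p by blast
  have "(\<Sum>u\<in>{..L} \<times> {..m}. coeff (p (snd u)) (fst u) * deriv_term (fps_nth f) u J) = 0" for J
  proof -
    have "0 = fps_nth (\<Sum>i\<le>m. fps_of_poly (p i) * (fps_deriv ^^ i) f) J"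
      by (simp add: eq)
    also have "\<dots> = (\<Sum>i\<le>m. \<Sum>l\<le>L. coeff (p i) l * deriv_term (fps_nth f) (l, i) J)"
      unfolding fps_sum_nth
    proof (rule sum.cong[OF refl])
      fix i assume "i \<in> {..m}"
      then have "p i = (\<Sum>l\<le>L. monom (coeff (p i) l) l)"
        using poly_as_sum_of_monoms'[of "p i" L] L by simp
      then have "fps_of_poly (p i) = (\<Sum>l\<le>L. fps_of_poly (monom (coeff (p i) l) l))"
        by (metis fps_of_poly_sum)
      then show "fps_nth (fps_of_poly (p i) * (fps_deriv ^^ i) f) J =
          (\<Sum>l\<le>L. coeff (p i) l * deriv_term (fps_nth f) (l, i) J)"
        by (simp only: sum_distrib_right fps_sum_nth fps_nth_monom_mult_deriv)
    qed
    finally show ?thesis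
      by (subst (asm) sum.swap) (simp add: sum.cartesian_product case_prod_beta)
  qed
  moreover have "(degree (p i), i) \<in> {..L} \<times> {..m}" using i L by auto
  moreover have "coeff (p (snd (degree (p i), i))) (fst (degree (p i), i)) \<noteq> 0"
    using i by simp
  ultimately show "\<exists>U v. finite U \<and> (\<exists>u\<in>U. v u \<noteq> 0) \<and>
      (\<forall>J. (\<Sum>u\<in>U. v u * deriv_term (fps_nth f) u J) = 0)"
    by (intro exI[of _ "{..L} \<times> {..m}"] exI[of _ "\<lambda>u. coeff (p (snd u)) (fst u)"]) blast
next
  assume "\<exists>U v. finite U \<and> (\<exists>u\<in>U. v u \<noteq> 0) \<and>
      (\<forall>J. (\<Sum>u\<in>U. v u * deriv_term (fps_nth f) u J) = 0)"
  then obtain U v u0 where U: "finite U" and u0: "u0 \<in> U" "v u0 \<noteq> 0"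
    and eq: "\<And>J. (\<Sum>u\<in>U. v u * deriv_term (fps_nth f) u J) = 0" by blast
  define m where "m = Max (snd ` U)"
  have m: "snd ` U \<subseteq> {..m}" unfolding m_def using Max_ge[of "snd ` U"] U by blast
  define p where "p t = (\<Sum>u | u \<in> U \<and> snd u = t. monom (v u) (fst u))" for t
  \<comment> \<open>Pairs with equal \<open>snd\<close> have distinct \<open>fst\<close>, so the
    monomials collected in \<open>p t\<close> cannot cancel.\<close>
  have "coeff (p (snd u0)) (fst u0) =
      (\<Sum>u | u \<in> U \<and> snd u = snd u0. if u = u0 then v u else 0)"
    unfolding p_def coeff_sum by (rule sum.cong) (auto simp: prod_eq_iff)
  also have "\<dots> = v u0" using u0 U by (simp add: sum.delta)
  finally have "p (snd u0) \<noteq> 0" using u0 by auto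
  moreover have "snd u0 \<le> m" using m u0 by auto
  moreover have "(\<Sum>i\<le>m. fps_of_poly (p i) * (fps_deriv ^^ i) f) = 0"
  proof (rule fps_ext)
    fix J
    have "fps_nth (\<Sum>i\<le>m. fps_of_poly (p i) * (fps_deriv ^^ i) f) J =
        (\<Sum>i\<le>m. \<Sum>u | u \<in> U \<and> snd u = i. v u * deriv_term (fps_nth f) u J)"
      unfolding fps_sum_nth p_def fps_of_poly_sum sum_distrib_right
      by (intro sum.cong refl) (auto simp: fps_nth_monom_mult_deriv)
    also have "\<dots> = (\<Sum>u\<in>U. v u * deriv_term (fps_nth f) u J)"
      by (rule sum.group) (use U m in auto)
    finally show "fps_nth (\<Sum>i\<le>m. fps_of_poly (p i) * (fps_deriv ^^ i) f) J = fps_nth 0 J"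
      by (simp add: eq)
  qed
  ultimately show "D_finite f" unfolding D_finite_def by blast
qed

section \<open>Underdetermined linear systems\<close>

text \<open>Gaussian elimination, by induction on the number of equations: the equation
  \<open>f\<close> removes the unknown \<open>u0\<close>. Reduced equations may coincide in the set
  \<open>G\<close>, which only lowers the count.\<close>

lemma underdetermined_system_solution:
  fixes F :: "('b \<Rightarrow> 'a::field) set"
  assumes "finite F" "finite U" "card F < card U"
  shows "\<exists>v. (\<exists>u\<in>U. v u \<noteq> 0) \<and> (\<forall>f\<in>F. (\<Sum>u\<in>U. f u * v u) = 0)"
  using assms
proof (induction "card F" arbitrary: F U rule: less_induct)
  case less
  show ?case
  proof (cases "\<exists>f\<in>F. \<exists>u\<in>U. f u \<noteq> 0")
    case False
    moreover obtain u where "u \<in> U" using less.prems by fastforce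
    ultimately show ?thesis by (intro exI[of _ "\<lambda>_. 1"]) auto
  next
    case True
    then obtain f u0 where f: "f \<in> F" and u0: "u0 \<in> U" "f u0 \<noteq> 0" by blast
    define G where "G = (\<lambda>g u. g u - g u0 / f u0 * f u) ` (F - {f})"
    have "card G \<le> card (F - {f})" unfolding G_def by (rule card_image_le) (use less in auto)
    moreover have "card (F - {f}) < card F"
      using f less.prems by (intro card_Diff1_less)
    moreover have "card (U - {u0}) = card U - 1" "card (F - {f}) = card F - 1"
      using u0 f less.prems by auto
    ultimately have "\<exists>v. (\<exists>u\<in>U - {u0}. v u \<noteq> 0) \<and> (\<forall>g\<in>G. (\<Sum>u\<in>U - {u0}. g u * v u) = 0)"
      using less.prems f by (intro less.hyps) (auto simp: G_def)
    then obtain v u1 where u1: "u1 \<in> U - {u0}" "v u1 \<noteq> 0"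
      and v: "\<And>g. g \<in> G \<Longrightarrow> (\<Sum>u\<in>U - {u0}. g u * v u) = 0" by blast
    \<comment> \<open>The value at \<open>u0\<close> is the one that satisfies the equation
      \<open>f\<close>.\<close>
    define w where "w = v(u0 := - (\<Sum>u\<in>U - {u0}. f u * v u) / f u0)"
    have split: "(\<Sum>u\<in>U. g u * w u) = g u0 * w u0 + (\<Sum>u\<in>U - {u0}. g u * v u)" for g
    proof -
      have "(\<Sum>u\<in>U. g u * w u) = g u0 * w u0 + (\<Sum>u\<in>U - {u0}. g u * w u)"
        using less.prems u0 by (intro sum.remove) auto
      also have "(\<Sum>u\<in>U - {u0}. g u * w u) = (\<Sum>u\<in>U - {u0}. g u * v u)"
        by (rule sum.cong) (auto simp: w_def)
      finally show ?thesis .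
    qed
    have "(\<Sum>u\<in>U. g u * w u) = 0" if "g \<in> F" for g
    proof (cases "g = f")
      case True
      then show ?thesis using u0 by (simp add: split) (simp add: w_def)
    next
      case False
      then have "(\<Sum>u\<in>U - {u0}. (g u - g u0 / f u0 * f u) * v u) = 0"
        using that by (intro v) (auto simp: G_def)
      then have "(\<Sum>u\<in>U - {u0}. g u * v u) = g u0 / f u0 * (\<Sum>u\<in>U - {u0}. f u * v u)"
        by (simp add: algebra_simps sum_subtractf sum_distrib_left)
      then show ?thesis by (simp add: split) (simp add: w_def)
    qed
    moreover have "w u1 \<noteq> 0" "u1 \<in> U" using u1 by (auto simp: w_def)
    ultimately show ?thesis by blast
  qed
qed

section \<open>Independence of exponentials with polynomial coefficients\<close>

lemma poly_eq_0_if_zero_on_nats: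
  fixes p :: "'a::{idom,ring_char_0} poly"
  assumes "\<And>j::nat. poly p (of_nat j) = 0"
  shows "p = 0"
proof (rule ccontr)
  assume "p \<noteq> 0"
  then have "finite {x. poly p x = 0}" by (rule poly_roots_finite)
  moreover have "range (of_nat :: nat \<Rightarrow> 'a) \<subseteq> {x. poly p x = 0}" using assms by auto
  ultimately have "finite (range (of_nat :: nat \<Rightarrow> 'a))" by (rule rev_finite_subset)
  then show False
    using finite_imageD[of "of_nat :: nat \<Rightarrow> 'a" UNIV] by (simp add: inj_of_nat)
qed

lemma degree_pcompose_shift_diff:
  fixes p :: "'a::{idom} poly"
  assumes "degree p > 0"
  shows "degree (pcompose p [:1, 1:] - p) < degree p"
proof (rule degree_lessI)
  have deg: "degree (pcompose p [:1, 1:]) = degree p" by (simp add: degree_pcompose)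
  show "pcompose p [:1, 1:] - p \<noteq> 0 \<or> degree p > 0" using assms by simp
  show "\<forall>k\<ge>degree p. coeff (pcompose p [:1, 1:] - p) k = 0"
  proof (intro allI impI)
    fix k assume "k \<ge> degree p"
    moreover have "lead_coeff (pcompose p [:1, 1:]) = lead_coeff p"
      by (subst lead_coeff_comp) auto
    ultimately show "coeff (pcompose p [:1, 1:] - p) k = 0"
      by (cases "k = degree p") (auto simp: deg coeff_eq_0)
  qed
qed

text \<open>Apply the shift operator minus \<open>\<beta>\<close>: it lowers the degree of the coefficient of
  \<open>\<beta> ^ j\<close> and preserves the degrees of all others.\<close>

lemma exponential_polynomials_independent:
  fixes g :: "'a::{idom,ring_char_0} \<Rightarrow> 'a poly"
  assumes "finite B" "0 \<notin> B"
    and "\<And>j::nat. (\<Sum>\<beta>\<in>B. poly (g \<beta>) (of_nat j) * \<beta> ^ j) = 0"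
    and "\<beta> \<in> B"
  shows "g \<beta> = 0"
  using assms
proof (induction B arbitrary: g \<beta> rule: finite_induct)
  case (insert x B)
  have IH: "g \<gamma> = 0"
    if "\<And>j::nat. (\<Sum>\<beta>\<in>B. poly (g \<beta>) (of_nat j) * \<beta> ^ j) = 0" "\<gamma> \<in> B" for g \<gamma>
    by (rule insert.IH) (use that insert.prems in auto)
  \<comment> \<open>Inner induction on a degree bound \<open>d\<close> for \<open>g x\<close>. For
    \<open>d = 0\<close> the term at \<open>x\<close> is zero, and the outer hypothesis applies to
    the sum over \<open>B\<close>.\<close>
  have others: "\<forall>\<gamma>\<in>B. g \<gamma> = 0"
    if "\<And>j::nat. (\<Sum>\<beta>\<in>insert x B. poly (g \<beta>) (of_nat j) * \<beta> ^ j) = 0"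
      "g x = 0 \<or> degree (g x) < d" for g d
    using that
  proof (induction d arbitrary: g)
    case 0
    then show ?case using insert.hyps by (intro ballI IH) auto
  next
    case (Suc d)
    define h where "h \<gamma> = smult \<gamma> (pcompose (g \<gamma>) [:1, 1:]) - smult x (g \<gamma>)" for \<gamma>
    have "(\<Sum>\<beta>\<in>insert x B. poly (h \<beta>) (of_nat j) * \<beta> ^ j) = 0" for j
    proof -
      have "(\<Sum>\<beta>\<in>insert x B. poly (h \<beta>) (of_nat j) * \<beta> ^ j) =
         (\<Sum>\<beta>\<in>insert x B. poly (g \<beta>) (of_nat (Suc j)) * \<beta> ^ Suc j)
         - x * (\<Sum>\<beta>\<in>insert x B. poly (g \<beta>) (of_nat j) * \<beta> ^ j)"
        unfolding sum_distrib_left sum_subtractf[symmetric]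
        by (intro sum.cong refl) (simp add: h_def poly_pcompose algebra_simps)
      then show ?thesis by (simp only: Suc.prems) simp
    qed
    moreover have "h x = 0 \<or> degree (h x) < d"
    proof (cases "degree (g x) = 0")
      case True
      then obtain c where "g x = [:c:]" by (metis degree_eq_zeroE)
      then show ?thesis by (simp add: h_def)
    next
      case False
      then have "degree (pcompose (g x) [:1, 1:] - g x) < degree (g x)"
        by (intro degree_pcompose_shift_diff) simp
      moreover have "degree (h x) \<le> degree (pcompose (g x) [:1, 1:] - g x)"
        unfolding h_def smult_diff_right[symmetric] by (rule degree_smult_le)
      ultimately show ?thesis using Suc.prems(2) False by auto
    qed
    ultimately have h0: "\<forall>\<gamma>\<in>B. h \<gamma> = 0" by (rule Suc.IH)
    show ?case
    proof
      fix \<gamma> assume \<gamma>: "\<gamma> \<in> B"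
      \<comment> \<open>As \<gamma> differs from \<open>x\<close>, the operator only scales this
        leading coefficient by a nonzero factor, so \<open>h \<gamma> = 0\<close> gives
        \<open>g \<gamma> = 0\<close>.\<close>
      have "lead_coeff (pcompose (g \<gamma>) [:1, 1:]) = lead_coeff (g \<gamma>)"
        by (subst lead_coeff_comp) auto
      then have "coeff (h \<gamma>) (degree (g \<gamma>)) = (\<gamma> - x) * lead_coeff (g \<gamma>)"
        by (simp add: h_def degree_pcompose algebra_simps)
      then have "(\<gamma> - x) * lead_coeff (g \<gamma>) = 0" using h0 \<gamma> by simp
      moreover have "\<gamma> \<noteq> x" using \<gamma> insert.hyps by auto
      ultimately show "g \<gamma> = 0" by simp
    qed
  qed
  have B0: "\<forall>\<gamma>\<in>B. g \<gamma> = 0"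
    by (rule others[where d = "Suc (degree (g x))"]) (use insert.prems in auto)
  have "poly (g x) (of_nat j) = 0" for j
    using insert.prems(2)[of j] insert.prems(1) insert.hyps B0 by simp
  then have "g x = 0" by (rule poly_eq_0_if_zero_on_nats)
  then show ?case using B0 insert.prems by auto
qed simp

text \<open>Expanding each \<open>H u\<close> in powers of \<open>q ^ j\<close> gives an exponential
  polynomial in \<open>j\<close> with bases \<open>q ^ t\<close>. These are pairwise distinct, so
  each coefficient polynomial vanishes.\<close>

lemma poly_in_index_and_power_eq_0:
  fixes q :: complex and P H :: "'b \<Rightarrow> complex poly"
  assumes "finite U" "q \<noteq> 0" "\<not> root_of_unity q"
    and eq: "\<And>j::nat. (\<Sum>u\<in>U. poly (P u) (of_nat j) * poly (H u) (q ^ j)) = 0"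
  shows "(\<Sum>u\<in>U. smult (coeff (H u) t) (P u)) = 0"
proof -
  have inj: "inj (\<lambda>t. q ^ t)"
  proof (rule linorder_injI)
    fix x y :: nat assume "x < y"
    then have "q ^ y = q ^ x * q ^ (y - x)" by (simp flip: power_add)
    moreover have "q ^ (y - x) \<noteq> 1"
      using assms(3) \<open>x < y\<close> unfolding root_of_unity_def by (metis zero_less_diff)
    ultimately show "q ^ x \<noteq> q ^ y" using assms(2) by auto
  qed
  \<comment> \<open>The summand \<open>t\<close> keeps the requested exponent in range even if it
    exceeds all degrees.\<close>
  define T where "T = t + (\<Sum>u\<in>U. degree (H u))"
  have T: "degree (H u) \<le> T" if "u \<in> U" for u
    using member_le_sum[of u U "\<lambda>u. degree (H u)"] that assms(1) by (simp add: T_def)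
  define g where "g t = (\<Sum>u\<in>U. smult (coeff (H u) t) (P u))" for t
  \<comment> \<open>The independence lemma indexes coefficients by the base \<beta>, so the exponent
    is recovered by \<open>inv\<close>.\<close>
  have "(\<Sum>\<beta>\<in>(\<lambda>t. q ^ t) ` {..T}. poly (g (inv (\<lambda>t. q ^ t) \<beta>)) (of_nat j) * \<beta> ^ j) = 0" for j
  proof -
    have "(\<Sum>\<beta>\<in>(\<lambda>t. q ^ t) ` {..T}. poly (g (inv (\<lambda>t. q ^ t) \<beta>)) (of_nat j) * \<beta> ^ j) =
        (\<Sum>t\<le>T. poly (g t) (of_nat j) * (q ^ t) ^ j)"
      by (subst sum.reindex) (auto intro: inj_on_subset[OF inj] simp: inv_f_f[OF inj])
    also have "\<dots> = (\<Sum>t\<le>T. \<Sum>u\<in>U. poly (P u) (of_nat j) * (coeff (H u) t * (q ^ j) ^ t))"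
      by (simp add: g_def poly_sum sum_distrib_right sum_distrib_left mult_ac flip: power_mult)
    also have "\<dots> = (\<Sum>u\<in>U. poly (P u) (of_nat j) * (\<Sum>t\<le>T. coeff (H u) t * (q ^ j) ^ t))"
      by (subst sum.swap) (simp add: sum_distrib_left)
    also have "\<dots> = (\<Sum>u\<in>U. poly (P u) (of_nat j) * poly (H u) (q ^ j))"
    proof (intro sum.cong refl arg_cong2[where f = "(*)"])
      fix u assume "u \<in> U"
      then have "H u = (\<Sum>t\<le>T. monom (coeff (H u) t) t)"
        using poly_as_sum_of_monoms' T by metis
      then have "poly (H u) (q ^ j) = poly (\<Sum>t\<le>T. monom (coeff (H u) t) t) (q ^ j)" by simp
      then show "(\<Sum>t\<le>T. coeff (H u) t * (q ^ j) ^ t) = poly (H u) (q ^ j)"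
        by (simp add: poly_sum poly_monom)
    qed
    finally show ?thesis by (simp add: eq)
  qed
  then have "g (inv (\<lambda>t. q ^ t) (q ^ t)) = 0"
    by (intro exponential_polynomials_independent[where B = "(\<lambda>t. q ^ t) ` {..T}"
          and g = "\<lambda>\<beta>. g (inv (\<lambda>t. q ^ t) \<beta>)"]) (use assms(2) in \<open>auto simp: T_def\<close>)
  then show ?thesis by (simp add: inv_f_f[OF inj] g_def)
qed

section \<open>Binomial coefficients under shifts of the index\<close>

text \<open>Covers both ordinary binomials (\<open>\<phi> i = i\<close>) and \<open>q\<close>-binomials (\<open>\<phi> i = 1 - q ^ i\<close>). For
  \<open>s \<le> S\<close>, the dependence on \<open>s\<close> is confined to the three products.\<close>

lemma generalized_binomial_shift:
  fixes \<phi> :: "nat \<Rightarrow> 'a::field" and C :: "nat \<Rightarrow> nat \<Rightarrow> 'a"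
  assumes nz: "\<And>i. i > 0 \<Longrightarrow> \<phi> i \<noteq> 0"
    and C: "\<And>N K. K \<le> N \<Longrightarrow>
      C N K * ((\<Prod>i=1..K. \<phi> i) * (\<Prod>i=1..N - K. \<phi> i)) = (\<Prod>i=1..N. \<phi> i)"
    and "s \<le> S"
  shows "C (K + M + (b + d) * s) (K + b * s) =
     (\<Prod>i=1..K + M. \<phi> i) / ((\<Prod>i=1..K + b * S. \<phi> i) * (\<Prod>i=1..M + d * S. \<phi> i)) *
     ((\<Prod>t<(b + d) * s. \<phi> (K + M + 1 + t)) *
      (\<Prod>t<b * (S - s). \<phi> (K + b * s + 1 + t)) *
      (\<Prod>t<d * (S - s). \<phi> (M + d * s + 1 + t)))"
proof -
  have split: "(\<Prod>i=1..x + y. \<phi> i) = (\<Prod>i=1..x. \<phi> i) * (\<Prod>t<y. \<phi> (x + 1 + t))" for x y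
    by (induction y) (simp_all add: mult.assoc)
  have F: "(\<Prod>i=1..x. \<phi> i) \<noteq> 0" for x using nz by (simp add: prod_zero_iff)
  obtain r where r: "S = s + r" using \<open>s \<le> S\<close> le_Suc_ex by blast
  have "C (K + M + (b + d) * s) (K + b * s) *
      ((\<Prod>i=1..K + b * s. \<phi> i) * (\<Prod>i=1..M + d * s. \<phi> i)) =
      (\<Prod>i=1..K + M. \<phi> i) * (\<Prod>t<(b + d) * s. \<phi> (K + M + 1 + t))"
    using C[of "K + b * s" "K + M + (b + d) * s"] split[of "K + M" "(b + d) * s"]
    by (simp add: algebra_simps)
  then have "C (K + M + (b + d) * s) (K + b * s) =
      (\<Prod>i=1..K + M. \<phi> i) * (\<Prod>t<(b + d) * s. \<phi> (K + M + 1 + t)) /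
      ((\<Prod>i=1..K + b * s. \<phi> i) * (\<Prod>i=1..M + d * s. \<phi> i))"
    using F[of "K + b * s"] F[of "M + d * s"]
    by (subst eq_divide_eq) (simp del: prod_zero_iff)
  \<comment> \<open>Extending both denominators from \<open>s\<close> to \<open>S\<close> frees them
    from \<open>s\<close>; the added factors move to the numerator.\<close>
  moreover have "(\<Prod>i=1..K + b * S. \<phi> i) =
      (\<Prod>i=1..K + b * s. \<phi> i) * (\<Prod>t<b * (S - s). \<phi> (K + b * s + 1 + t))"
    using split[of "K + b * s" "b * r"] by (simp add: r algebra_simps)
  moreover have "(\<Prod>i=1..M + d * S. \<phi> i) =
      (\<Prod>i=1..M + d * s. \<phi> i) * (\<Prod>t<d * (S - s). \<phi> (M + d * s + 1 + t))"
    using split[of "M + d * s" "d * r"] by (simp add: r algebra_simps)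
  moreover have "(\<Prod>t<b * (S - s). \<phi> (K + b * s + 1 + t)) \<noteq> 0"
     "(\<Prod>t<d * (S - s). \<phi> (M + d * s + 1 + t)) \<noteq> 0"
    using nz by (auto simp: prod_zero_iff)
  ultimately show ?thesis by simp
qed

section \<open>D-finiteness from hypergeometric sections\<close>

lemma degree_prod_linear_le:
  fixes x y :: "nat \<Rightarrow> 'a::idom"
  shows "degree (\<Prod>t<N. [:x t, y t:]) \<le> N"
proof -
  have "degree (\<Prod>t<N. [:x t, y t:]) \<le> (\<Sum>t<N. degree [:x t, y t:])"
    by (rule degree_prod_sum_le[unfolded o_def]) simp
  also have "\<dots> \<le> (\<Sum>t<N. 1)" by (rule sum_mono) simp
  finally show ?thesis by simp
qed

lemma poly_pochhammer: "poly (pochhammer p e) x = pochhammer (poly p x) e"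
  for p :: "'a::comm_ring_1 poly"
  by (simp add: pochhammer_prod poly_prod)

lemma degree_pochhammer_linear_le: "degree (pochhammer [:x, y:] e) \<le> e"
  for x y :: "'a::idom"
proof -
  have "pochhammer [:x, y:] e = (\<Prod>t<e. [:x + of_nat t, y:])"
    unfolding pochhammer_prod atLeast0LessThan by (rule prod.cong) (auto simp: of_nat_poly)
  then show ?thesis by (simp add: degree_prod_linear_le)
qed

text \<open>The hypothesis puts all the shifts of each section into a space of polynomials whose dimension
  grows linearly in \<open>D + I\<close>, against \<open>(D + 1) (I + 1)\<close> products of \<open>x ^ (m d)\<close> with derivatives
  of order \<open>m e\<close>.\<close>

lemma D_finite_if_sections_hypergeometric:
  fixes c :: "nat \<Rightarrow> complex"
  assumes m: "m > 0"
    and sect: "\<And>S r. r < m \<Longrightarrow> \<exists>W G. \<forall>s\<le>S. degree (G s) \<le> a * S \<and>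
      (\<forall>i. c (r + m * (i + s)) = W i * poly (G s) (of_nat i))"
  shows "D_finite (Abs_fps c)"
proof -
  \<comment> \<open>\<open>T\<close> bounds the degrees of the \<open>P r u\<close> below. With
    \<open>D = m * (m + a)\<close> the part of \<open>m * (T + 1)\<close> linear in \<open>I\<close>
    is exactly \<open>D * I\<close>; \<open>I\<close> then absorbs the remaining equations, which
    number \<open>m * a * D + m + m * D\<close>.\<close>
  define D where "D = m * (m + a)"
  define I where "I = m * a * D + m + m * D"
  define S where "S = D + I"
  define T where "T = m * I + a * S"
  have "\<forall>r. \<exists>W G. r < m \<longrightarrow> (\<forall>s\<le>S. degree (G s) \<le> a * S \<and>
      (\<forall>i. c (r + m * (i + s)) = W i * poly (G s) (of_nat i)))"
    using sect by meson
  then obtain W G where WG: "\<And>r s. r < m \<Longrightarrow> s \<le> S \<Longrightarrow> degree (G r s) \<le> a * S"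
      "\<And>r s i. r < m \<Longrightarrow> s \<le> S \<Longrightarrow> c (r + m * (i + s)) = W r i * poly (G r s) (of_nat i)"
    by metis
  \<comment> \<open>Only multiples of \<open>m\<close> occur, so that every index shift stays within
    one residue class modulo \<open>m\<close>.\<close>
  define U where "U = (\<lambda>(d, e). (m * d, m * e)) ` ({..D} \<times> {..I})"
  have U: "finite U" by (simp add: U_def)
  have "inj_on (\<lambda>(d, e). (m * d, m * e)) ({..D} \<times> {..I})"
    using m by (auto simp: inj_on_def)
  then have cardU: "card U = (D + 1) * (I + 1)"
    unfolding U_def by (subst card_image) auto
  \<comment> \<open>The starting index \<open>r + m * D\<close> makes all differences with
    \<open>fst u\<close> nonnegative; the divisions by \<open>m\<close> recover \<open>d\<close> and
    \<open>e\<close>.\<close>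
  define P where "P r u = pochhammer [:of_nat (r + m * D - fst u + 1), of_nat m:] (snd u) *
      G r (D - fst u div m + snd u div m)" for r and u :: "nat \<times> nat"
  have P: "degree (P r u) \<le> T \<and>
      deriv_term c u (r + m * (i + D)) = W r i * poly (P r u) (of_nat i)"
    if r: "r < m" and uU: "u \<in> U" for r u i
  proof -
    obtain d e where u: "u = (m * d, m * e)" "d \<le> D" "e \<le> I" using uU unfolding U_def by auto
    obtain D' where D': "D = d + D'" using u le_Suc_ex by blast
    have s: "D' + e \<le> S" using u D' by (simp add: S_def)
    have Pr: "P r u = pochhammer [:of_nat (r + m * D' + 1), of_nat m:] (m * e) * G r (D' + e)"
      using m by (simp add: P_def u D' algebra_simps)
    have "degree (P r u) \<le> m * e + a * S"
      unfolding Pr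
      by (rule order_trans[OF degree_mult_le])
        (rule add_mono[OF degree_pochhammer_linear_le WG(1)[OF r s]])
    also have "\<dots> \<le> T" using u by (simp add: T_def)
    finally have "degree (P r u) \<le> T" .
    moreover have "deriv_term c u (r + m * (i + D)) =
        pochhammer (of_nat (r + m * (i + D')) + 1) (m * e) * c (r + m * (i + (D' + e)))"
    proof -
      have "r + m * (i + D) - m * d = r + m * (i + D')" "m * d \<le> r + m * (i + D)"
        by (simp_all add: D' algebra_simps)
      then show ?thesis
        by (simp add: deriv_term_def u) (simp add: algebra_simps)
    qed
    moreover have "of_nat (r + m * (i + D')) + 1 =
        poly [:of_nat (r + m * D' + 1), of_nat m:] (of_nat i :: complex)"
      by (simp add: algebra_simps)
    ultimately show ?thesis
      using WG(2)[OF r s, of i] unfolding Pr poly_mult poly_pochhammer by (simp only: mult_ac)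
  qed
  \<comment> \<open>The first family makes the combination of the \<open>P r u\<close> the zero
    polynomial for every \<open>r\<close>. The second imposes directly the initial indices, which
    the polynomial formula does not reach.\<close>
  define F where "F = (\<lambda>(r, t) u. coeff (P r u) t) ` ({..<m} \<times> {..T}) \<union>
      (\<lambda>J u. deriv_term c u J) ` {..<m * D}"
  have F: "finite F" by (simp add: F_def)
  have "card F \<le> card ({..<m} \<times> {..T}) + card {..<m * D}"
    unfolding F_def by (rule order_trans[OF card_Un_le]) (intro add_mono card_image_le; simp)
  also have "\<dots> = m * (T + 1) + m * D" by simp
  also have "\<dots> < (D + 1) * (I + 1)"
  proof -
    have "m * (T + 1) = D * I + m * a * D + m"
      by (simp add: T_def S_def D_def algebra_simps)
    then show ?thesis by (simp add: I_def)
  qed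
  finally obtain v u0 where v: "u0 \<in> U" "v u0 \<noteq> 0"
      "\<And>f. f \<in> F \<Longrightarrow> (\<Sum>u\<in>U. f u * v u) = 0"
    using underdetermined_system_solution[OF F U] cardU by auto
  have "(\<Sum>u\<in>U. v u * deriv_term c u J) = 0" for J
  proof (cases "J < m * D")
    case True
    then show ?thesis
      using v(3)[of "\<lambda>u. deriv_term c u J"] by (simp add: F_def mult.commute)
  next
    case False
    define r where "r = J mod m"
    define i where "i = J div m - D"
    have r: "r < m" using m by (simp add: r_def)
    have "J div m \<ge> D" using False m by (simp add: less_eq_div_iff_mult_less_eq mult.commute)
    then have J: "J = r + m * (i + D)" by (simp add: r_def i_def)
    have "(\<Sum>u\<in>U. smult (v u) (P r u)) = 0"
    proof (rule poly_eqI)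
      fix t
      show "coeff (\<Sum>u\<in>U. smult (v u) (P r u)) t = coeff 0 t"
      proof (cases "t \<le> T")
        case True
        then have "(\<lambda>u. coeff (P r u) t) \<in> F" using r by (force simp: F_def)
        from v(3)[OF this] show ?thesis by (simp add: coeff_sum mult.commute)
      next
        case False
        then have "coeff (P r u) t = 0" if "u \<in> U" for u
          using conjunct1[OF P[OF r that]] by (intro coeff_eq_0) simp
        then show ?thesis by (simp add: coeff_sum)
      qed
    qed
    then have "0 = W r i * poly (\<Sum>u\<in>U. smult (v u) (P r u)) (of_nat i)" by simp
    also have "\<dots> = (\<Sum>u\<in>U. v u * deriv_term c u J)"
      unfolding J poly_sum sum_distrib_left
      by (rule sum.cong) (simp_all add: P[OF r])
    finally show ?thesis by simp
  qed
  moreover have nth: "fps_nth (Abs_fps c) = c" by (rule ext) simp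
  ultimately show ?thesis
    unfolding D_finite_iff_deriv_term nth using U v(1,2)
    by (intro exI[of _ U] exI[of _ v]) auto
qed

text \<open>With \<open>of_nat\<close> for \<phi>, all factors in
  \<open>generalized_binomial_shift\<close> are linear in \<open>i\<close>, and counting them gives
  the same degree bound for all \<open>s\<close>. This provides the sections needed for
  D-finiteness.\<close>

lemma binomial_shift_polynomial:
  "\<exists>W G. \<forall>s\<le>S. degree (G s) \<le> (b + d) * S \<and>
     (\<forall>i. of_nat ((K + M + (b + d) * (i + s)) choose (K + b * (i + s))) =
        (W i * poly (G s) (of_nat i) :: complex))"
proof -
  define W :: "nat \<Rightarrow> complex" where "W i = (\<Prod>j=1..K + b * i + (M + d * i). of_nat j) /
      ((\<Prod>j=1..K + b * i + b * S. of_nat j) * (\<Prod>j=1..M + d * i + d * S. of_nat j))" for i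
  define G :: "nat \<Rightarrow> complex poly" where "G s =
     (\<Prod>t<(b + d) * s. [:of_nat (K + M + 1 + t), of_nat (b + d):]) *
     (\<Prod>t<b * (S - s). [:of_nat (K + b * s + 1 + t), of_nat b:]) *
     (\<Prod>t<d * (S - s). [:of_nat (M + d * s + 1 + t), of_nat d:])" for s
  have "degree (G s) \<le> (b + d) * S" if "s \<le> S" for s
  proof -
    have "degree (G s) \<le> (b + d) * s + b * (S - s) + d * (S - s)"
      unfolding G_def
      by (intro order_trans[OF degree_mult_le] add_mono degree_prod_linear_le)
    also have "\<dots> = (b + d) * (s + (S - s))" by (simp add: algebra_simps)
    finally show ?thesis using that by simp
  qed
  moreover have "of_nat ((K + M + (b + d) * (i + s)) choose (K + b * (i + s))) =
        W i * poly (G s) (of_nat i)" if "s \<le> S" for s i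
  proof -
    have "of_nat (N choose L) * ((\<Prod>i=1..L. of_nat i) * (\<Prod>i=1..N - L. of_nat i)) =
        (\<Prod>i=1..N. of_nat i :: complex)" if "L \<le> N" for N L
      using binomial_fact_lemma[OF that]
      by (simp add: fact_prod flip: of_nat_prod of_nat_mult) (simp add: mult_ac)
    from generalized_binomial_shift[where \<phi> = of_nat and C = "\<lambda>N L. of_nat (N choose L)"
        and K = "K + b * i" and M = "M + d * i" and b = b and d = d, OF _ this that]
    show ?thesis
      by (simp add: W_def G_def poly_prod algebra_simps)
  qed
  ultimately show ?thesis by blast
qed

section \<open>Evaluated q-factorials and q-binomials\<close>

lemma poly_q_int: "(1 - q) * poly (q_int m) q = 1 - q ^ m"
  by (simp add: q_int_def poly_sum poly_monom one_diff_power_eq)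

lemma poly_q_fact: "(1 - q) ^ m * poly (q_fact m) q = (\<Prod>i=1..m. 1 - q ^ i)"
proof -
  have "(\<Prod>i=1..m. 1 - q ^ i) = (\<Prod>i=1..m. (1 - q) * poly (q_int i) q)"
    by (simp add: poly_q_int)
  also have "\<dots> = (1 - q) ^ m * poly (q_fact m) q"
    by (simp add: q_fact_def poly_prod prod.distrib)
  finally show ?thesis by simp
qed

lemma q_binomial_exact_eval:
  "K \<le> N \<Longrightarrow> q_binomial q N K * (poly (q_fact K) q * poly (q_fact (N - K)) q) = poly (q_fact N) q"
  using arg_cong[OF q_binomial_exact, of K N "\<lambda>p. poly p q"] by (simp add: q_binomial_def)

lemma q_fact_nonzero: "q_fact m \<noteq> 0"
proof -
  have "poly (q_fact m) 1 = fact m"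
    by (simp add: q_fact_def poly_prod q_int_def poly_sum poly_monom fact_prod)
  then show ?thesis by auto
qed

lemma q_binomial_self: "q_binomial q N N = 1"
  using q_binomial_exact[of N N] q_fact_nonzero[of N]
  by (simp add: q_binomial_def q_fact_def)

lemma q_binomial_0: "q_binomial q N 0 = 1"
  using q_binomial_exact[of 0 N] q_fact_nonzero[of N]
  by (simp add: q_binomial_def q_fact_def)

text \<open>Proved in the polynomial ring, where q-factorials are nonzero and cancel; after
  evaluation they may vanish.\<close>

lemma q_binomial_pascal:
  assumes "K < N"
  shows "q_binomial q (Suc N) (Suc K) = q_binomial q N K + q ^ Suc K * q_binomial q N (Suc K)"
proof -
  obtain d where d: "N = Suc (K + d)" using assms less_iff_Suc_add by auto
  let ?B = q_binomial_poly
  have "(?B N K + monom 1 (Suc K) * ?B N (Suc K)) * (q_fact (Suc K) * q_fact (Suc d)) =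
      ?B N K * (q_fact K * q_fact (Suc d)) * q_int (Suc K) +
      monom 1 (Suc K) * (?B N (Suc K) * (q_fact (Suc K) * q_fact d)) * q_int (Suc d)"
    by (simp add: q_fact_Suc algebra_simps)
  also have "\<dots> = q_fact N * (q_int (Suc K) + monom 1 (Suc K) * q_int (Suc d))"
    using q_binomial_exact[of K N] q_binomial_exact[of "Suc K" N] by (simp add: d algebra_simps)
  also have "\<dots> = q_fact (Suc N)"
    using q_int_add[of "Suc K" "Suc d"] by (simp add: d q_fact_Suc)
  also have "\<dots> = ?B (Suc N) (Suc K) * (q_fact (Suc K) * q_fact (Suc d))"
    using q_binomial_exact[of "Suc K" "Suc N"] by (simp add: d)
  finally have "?B (Suc N) (Suc K) = ?B N K + monom 1 (Suc K) * ?B N (Suc K)"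
    using q_fact_nonzero by simp
  then show ?thesis by (simp add: q_binomial_def poly_monom)
qed

section \<open>The q-Lucas theorem\<close>

text \<open>The quotient defining \<open>q_binomial_poly N K\<close> is junk for \<open>K > N\<close>: it is \<open>1\<close> for \<open>N = 0\<close>, \<open>K = 1\<close>.\<close>

definition gauss_binomial :: "complex \<Rightarrow> nat \<Rightarrow> nat \<Rightarrow> complex" where
  "gauss_binomial q N K = (if K \<le> N then q_binomial q N K else 0)"

lemma gauss_binomial_0: "gauss_binomial q N 0 = 1"
  by (simp add: gauss_binomial_def q_binomial_0)

lemma gauss_binomial_self: "gauss_binomial q N N = 1"
  by (simp add: gauss_binomial_def q_binomial_self)

lemma gauss_binomial_Suc_Suc:
  "gauss_binomial q (Suc N) (Suc K) =
     gauss_binomial q N K + q ^ Suc K * gauss_binomial q N (Suc K)"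
  using q_binomial_pascal[of K N q]
  by (cases K N rule: linorder_cases) (auto simp: gauss_binomial_def q_binomial_self)

text \<open>The q-integer of \<open>m\<close> vanishes at \<open>q\<close> but no smaller positive
  one does: the numerator is zero, the denominator is not.\<close>

lemma gauss_binomial_root_of_unity_eq_0:
  assumes "q ^ m = 1" "\<And>i. 0 < i \<Longrightarrow> i < m \<Longrightarrow> q ^ i \<noteq> 1" "0 < K" "K < m"
  shows "gauss_binomial q m K = 0"
proof -
  have q1: "q \<noteq> 1" using assms(2)[of 1] assms(3,4) by auto
  have "poly (q_int i) q \<noteq> 0" if "0 < i" "i < m" for i
    using poly_q_int[of q i] assms(2)[OF that] by auto
  then have F: "poly (q_fact i) q \<noteq> 0" if "i < m" for i
    using that by (auto simp: q_fact_def poly_prod prod_zero_iff)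
  have "poly (q_int m) q = 0" using poly_q_int[of q m] assms(1) q1 by simp
  then have "poly (q_fact m) q = 0"
    using assms(3,4) by (auto simp: q_fact_def poly_prod prod_zero_iff)
  then have "q_binomial q m K * (poly (q_fact K) q * poly (q_fact (m - K)) q) = 0"
    using q_binomial_exact_eval[of K m q] assms(4) by simp
  then show ?thesis using F[of K] F[of "m - K"] assms(3,4) by (simp add: gauss_binomial_def)
qed

text \<open>Induction on \<open>N\<close> by the q-Pascal rule. The power of \<open>q\<close> in it
  depends only on the residue, so the cases differ only in which of the two indices carries into its
  quotient.\<close>

theorem q_Lucas:
  assumes m: "m > 0" "q ^ m = 1" "\<And>i. 0 < i \<Longrightarrow> i < m \<Longrightarrow> q ^ i \<noteq> 1"
  shows "gauss_binomial q N K =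
    of_nat ((N div m) choose (K div m)) * gauss_binomial q (N mod m) (K mod m)"
proof (induction N arbitrary: K)
  case 0
  show ?case
  proof (cases "K div m = 0")
    case True
    then show ?thesis using m by (simp add: div_eq_0_iff)
  next
    case False
    moreover from this have "K > 0" by (cases K) auto
    ultimately show ?thesis by (simp add: gauss_binomial_def binomial_eq_0)
  qed
next
  case (Suc N)
  show ?case
  proof (cases K)
    case 0
    then show ?thesis by (simp add: gauss_binomial_0)
  next
    case (Suc K')
    have pow: "q ^ Suc K' = q ^ Suc (K' mod m)"
    proof -
      have "q ^ K' = q ^ (m * (K' div m) + K' mod m)" by simp
      also have "\<dots> = q ^ (K' mod m)" unfolding power_add power_mult m(2) by simp
      finally show ?thesis by simp
    qed
    have step: "gauss_binomial q (Suc N) K =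
        of_nat ((N div m) choose (K' div m)) * gauss_binomial q (N mod m) (K' mod m) +
        q ^ Suc (K' mod m) * (of_nat ((N div m) choose (Suc K' div m)) *
          gauss_binomial q (N mod m) (Suc K' mod m))"
      unfolding Suc gauss_binomial_Suc_Suc pow Suc.IH[symmetric] ..
    have lt: "N mod m < m" "K' mod m < m" using m by auto
    consider "Suc (N mod m) \<noteq> m" "Suc (K' mod m) \<noteq> m" | "Suc (N mod m) \<noteq> m" "Suc (K' mod m) = m"
      | "Suc (N mod m) = m" "Suc (K' mod m) \<noteq> m" | "Suc (N mod m) = m" "Suc (K' mod m) = m"
      by blast
    then show ?thesis
    proof cases
      case 1
      then show ?thesis
        by (simp add: step) (simp add: Suc div_Suc mod_Suc gauss_binomial_Suc_Suc algebra_simps)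
    next
      \<comment> \<open>Only the lower index carries: the first q-Pascal term is zero and the second
        has power \<open>1\<close>.\<close>
      case 2
      then have "N mod m < K' mod m" using lt by linarith
      then have "gauss_binomial q (N mod m) (K' mod m) = 0"
        by (simp add: gauss_binomial_def)
      moreover have "q ^ Suc (K' mod m) = 1" using 2 m by simp
      ultimately show ?thesis
        using 2 unfolding step by (simp add: Suc div_Suc mod_Suc gauss_binomial_0)
    next
      \<comment> \<open>Only the upper index carries: the two quotient binomials agree, and the
        residue factors recombine to a q-binomial with upper index \<open>m\<close>, which
        vanishes.\<close>
      case 3
      have "gauss_binomial q (N mod m) (K' mod m) +
          q ^ Suc (K' mod m) * gauss_binomial q (N mod m) (Suc (K' mod m)) =
          gauss_binomial q m (Suc (K' mod m))"
        unfolding gauss_binomial_Suc_Suc[symmetric] by (simp only: 3)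
      also have "\<dots> = 0"
        using m lt(2) 3(2) by (intro gauss_binomial_root_of_unity_eq_0) (auto intro: Suc_lessI)
      finally have "of_nat ((N div m) choose (K' div m)) *
          (gauss_binomial q (N mod m) (K' mod m) +
          q ^ Suc (K' mod m) * gauss_binomial q (N mod m) (Suc (K' mod m))) = 0"
        by simp
      then show ?thesis
        using 3 unfolding step
        by (simp add: Suc div_Suc mod_Suc algebra_simps gauss_binomial_def)
    next
      \<comment> \<open>Both carry: all residue factors are \<open>1\<close>, leaving the ordinary
        Pascal rule for the quotients.\<close>
      case 4
      then have "N mod m = K' mod m" by linarith
      then have "q ^ Suc (K' mod m) = 1" "gauss_binomial q (N mod m) (K' mod m) = 1"
        using 4 m(2) by (simp_all only: gauss_binomial_self)
      then show ?thesis
        using 4 unfolding step by (simp add: Suc div_Suc mod_Suc gauss_binomial_0)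
    qed
  qed
qed

section \<open>Roots of unity give D-finite series\<close>

lemma D_finite_h_series_root_of_unity:
  assumes "k \<le> n" "b \<le> a" "root_of_unity q"
  shows "D_finite (h_series n k a b q)"
proof -
  define m where "m = (LEAST m. m > 0 \<and> q ^ m = 1)"
  have ex: "\<exists>m. m > 0 \<and> q ^ m = 1" using assms(3) by (simp add: root_of_unity_def)
  have m: "m > 0" "q ^ m = 1" using LeastI_ex[OF ex] by (auto simp: m_def)
  have least: "q ^ i \<noteq> 1" if "0 < i" "i < m" for i
    using not_less_Least[of i "\<lambda>m. m > 0 \<and> q ^ m = 1"] that by (auto simp: m_def)
  show ?thesis unfolding h_series_def
  proof (rule D_finite_if_sections_hypergeometric[where m = m and a = a])
    show "m > 0" by (rule m)
    fix S r assume "r < m"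
    define d where "d = a - b"
    define K where "K = (k + b * r) div m"
    define M where "M = (n + a * r) div m - K"
    \<comment> \<open>Replacing \<open>r\<close> by \<open>r + m * i\<close> adds multiples of
      \<open>m\<close> to both indices. Their residues, hence \<kappa>, stay fixed while the
      quotients grow linearly in \<open>i\<close>.\<close>
    define \<kappa> where "\<kappa> = gauss_binomial q ((n + a * r) mod m) ((k + b * r) mod m)"
    have a: "a = b + d" using assms by (simp add: d_def)
    have "k + b * r \<le> n + a * r" using assms by (intro add_mono mult_right_mono) auto
    then have A: "(n + a * r) div m = K + M"
      unfolding M_def K_def by (simp add: div_le_mono)
    have eq: "q_binomial q (n + a * (r + m * i)) (k + b * (r + m * i)) =
        of_nat ((K + M + (b + d) * i) choose (K + b * i)) * \<kappa>" for i
    proof -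
      have "k + b * (r + m * i) \<le> n + a * (r + m * i)"
        using assms by (intro add_mono mult_right_mono) auto
      then have "q_binomial q (n + a * (r + m * i)) (k + b * (r + m * i)) =
          gauss_binomial q (n + a * (r + m * i)) (k + b * (r + m * i))"
        by (simp add: gauss_binomial_def)
      also have "\<dots> = gauss_binomial q (n + a * r + m * (a * i)) (k + b * r + m * (b * i))"
        by (simp add: algebra_simps)
      also have "\<dots> = of_nat ((K + M + a * i) choose (K + b * i)) * \<kappa>"
        by (subst q_Lucas[OF m least])
          (use m(1) in \<open>simp_all add: A K_def[symmetric] \<kappa>_def add.commute\<close>)
      finally show ?thesis by (simp add: a)
    qed
    obtain W G where "\<forall>s\<le>S. degree (G s) \<le> (b + d) * S \<and>
       (\<forall>i. of_nat ((K + M + (b + d) * (i + s)) choose (K + b * (i + s))) =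
        (W i * poly (G s) (of_nat i) :: complex))"
      using binomial_shift_polynomial by blast
    then show "\<exists>W G. \<forall>s\<le>S. degree (G s) \<le> a * S \<and>
      (\<forall>i. q_binomial q (n + a * (r + m * (i + s))) (k + b * (r + m * (i + s))) =
        W i * poly (G s) (of_nat i))"
      unfolding eq by (intro exI[of _ "\<lambda>i. \<kappa> * W i"] exI[of _ G]) (simp add: a)
  qed
qed

section \<open>Other values of q exclude D-finiteness\<close>

lemma degree_one_minus_monom:
  fixes x :: "'a::comm_ring_1"
  assumes "x \<noteq> 0" "e > 0"
  shows "degree (1 - monom x e) = e"
proof -
  have "degree (monom (- x) e + 1) = degree (monom (- x) e)"
    by (rule degree_add_eq_left) (use assms in \<open>simp add: degree_monom_eq\<close>)
  then show ?thesis using assms by (simp add: degree_monom_eq minus_monom[symmetric])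
qed

lemma degree_prod_one_minus_monom:
  fixes x :: "nat \<Rightarrow> 'a::idom"
  assumes "\<And>t. x t \<noteq> 0" "e > 0"
  shows "degree (\<Prod>t<N. 1 - monom (x t) e) = e * N" "(\<Prod>t<N. 1 - monom (x t) e) \<noteq> 0"
proof -
  have nz: "1 - monom (x t) e \<noteq> 0" for t
    using degree_one_minus_monom[OF assms(1) assms(2), of t] assms(2) by force
  then show "(\<Prod>t<N. 1 - monom (x t) e) \<noteq> 0" by (simp add: prod_zero_iff)
  have "degree (\<Prod>t<N. 1 - monom (x t) e) = (\<Sum>t<N. degree (1 - monom (x t) e))"
    using nz by (intro degree_prod_sum_eq[unfolded o_def]) auto
  then show "degree (\<Prod>t<N. 1 - monom (x t) e) = e * N"
    by (simp add: degree_one_minus_monom[OF assms])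
qed

text \<open>The degrees increase with \<open>s\<close> because \<open>(b + d)\<^sup>2 > b\<^sup>2 + d\<^sup>2\<close>.\<close>

lemma q_binomial_shift_polynomial:
  assumes q: "q \<noteq> 0" "\<not> root_of_unity q" and bd: "b > 0" "d > 0"
  shows "\<exists>W H. (\<forall>j. W j \<noteq> 0) \<and> (\<forall>s\<le>S. H s \<noteq> 0) \<and>
     (\<forall>s'\<le>S. \<forall>s<s'. degree (H s) < degree (H s')) \<and>
     (\<forall>s\<le>S. \<forall>j. q_binomial q (K + M + (b + d) * (j + s)) (K + b * (j + s)) =
        W j * poly (H s) (q ^ j))"
proof -
  define \<phi> where "\<phi> i = 1 - q ^ i" for i
  have \<phi>: "\<phi> i \<noteq> 0" if "i > 0" for i
  proof -
    have "q ^ i \<noteq> 1" using q(2) that unfolding root_of_unity_def by blast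
    then show ?thesis by (simp add: \<phi>_def)
  qed
  have F: "(\<Prod>j=1..x. \<phi> j) \<noteq> 0" for x using \<phi> by (simp add: prod_zero_iff)
  define W where "W i = (\<Prod>j=1..K + b * i + (M + d * i). \<phi> j) /
      ((\<Prod>j=1..K + b * i + b * S. \<phi> j) * (\<Prod>j=1..M + d * i + d * S. \<phi> j))" for i
  \<comment> \<open>Each factor \<open>1 - q ^ (x + j * e)\<close> is a polynomial in
    \<open>q ^ j\<close>.\<close>
  define H where "H s =
     (\<Prod>t<(b + d) * s. 1 - monom (q ^ (K + M + 1 + t)) (b + d)) *
     (\<Prod>t<b * (S - s). 1 - monom (q ^ (K + b * s + 1 + t)) b) *
     (\<Prod>t<d * (S - s). 1 - monom (q ^ (M + d * s + 1 + t)) d)" for s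
  have prods: "degree (\<Prod>t<N. 1 - monom (q ^ (x + t)) e) = e * N"
    "(\<Prod>t<N. 1 - monom (q ^ (x + t)) e) \<noteq> 0" if "e > 0" for N x e
    using degree_prod_one_minus_monom[of "\<lambda>t. q ^ (x + t)" e N] q(1) that by auto
  have H0: "H s \<noteq> 0" for s
    unfolding H_def using bd by (intro no_zero_divisors prods) simp_all
  have degH: "degree (H s) = (b + d) * ((b + d) * s) + b * (b * (S - s)) + d * (d * (S - s))" for s
    unfolding H_def using bd
    by (subst degree_mult_eq, (intro no_zero_divisors prods; simp),
        (intro no_zero_divisors prods; simp))+ (simp only: prods add_pos_pos)
  have "degree (H s) < degree (H s')" if "s < s'" "s' \<le> S" for s s'
  proof -
    define x y where "x = s' - s" and "y = S - s'"
    then have x: "s' = s + x" "x > 0" and y: "S = s + x + y" using that by auto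
    \<comment> \<open>The two degrees differ by \<open>2 * b * d * x\<close>.\<close>
    have "b * d * x > 0" using bd x by simp
    then show ?thesis by (simp add: degH x y algebra_simps)
  qed
  moreover have "W j \<noteq> 0" for j using \<phi> by (auto simp: W_def)
  moreover have "q_binomial q (K + M + (b + d) * (j + s)) (K + b * (j + s)) =
        W j * poly (H s) (q ^ j)" if "s \<le> S" for s j
  proof -
    have factor: "poly (1 - monom (q ^ x) e) (q ^ j) = \<phi> (x + j * e)" for x e
      by (simp add: poly_monom \<phi>_def power_add power_mult)
    have "q_binomial q N L * ((\<Prod>i=1..L. \<phi> i) * (\<Prod>i=1..N - L. \<phi> i)) = (\<Prod>i=1..N. \<phi> i)"
      if "L \<le> N" for N L
    proof -
      have "q_binomial q N L * ((\<Prod>i=1..L. \<phi> i) * (\<Prod>i=1..N - L. \<phi> i)) =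
          (1 - q) ^ (L + (N - L)) *
          (q_binomial q N L * (poly (q_fact L) q * poly (q_fact (N - L)) q))"
        unfolding \<phi>_def poly_q_fact[symmetric] power_add by (simp only: mult_ac)
      then show ?thesis
        using that poly_q_fact[of q N] by (simp add: q_binomial_exact_eval \<phi>_def)
    qed
    from generalized_binomial_shift[where \<phi> = \<phi> and C = "q_binomial q"
        and K = "K + b * j" and M = "M + d * j" and b = b and d = d, OF \<phi> this that]
    show ?thesis
      unfolding W_def H_def poly_mult poly_prod factor by (simp add: algebra_simps)
  qed
  ultimately show ?thesis using H0 by blast
qed

lemma coeff_pochhammer_linear: "coeff (pochhammer [:x, 1:] e) e = 1"
  for x :: "'a::idom"
proof (induction e)
  case (Suc e)
  have "pochhammer [:x, 1:] (Suc e) = [:x + of_nat e, 1:] * pochhammer [:x, 1:] e"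
    by (simp add: pochhammer_Suc of_nat_poly)
  moreover have "coeff (pochhammer [:x, 1:] e) (Suc e) = 0"
    using degree_pochhammer_linear_le[of x 1 e] by (intro coeff_eq_0) simp
  ultimately show ?case using Suc by simp
qed simp

lemma root_of_unity_if_D_finite_h_series:
  assumes "k \<le> n" "0 < b" "b < a" "q \<noteq> 0" "D_finite (h_series n k a b q)"
  shows "root_of_unity q"
proof (rule ccontr)
  assume nru: "\<not> root_of_unity q"
  define d where "d = a - b"
  define M where "M = n - k"
  have a: "a = b + d" "d > 0" using assms by (simp_all add: d_def)
  have n: "n = k + M" using assms by (simp add: M_def)
  define c where "c j = q_binomial q (k + M + (b + d) * j) (k + b * j)" for j
  have "h_series n k a b q = Abs_fps c" by (simp add: h_series_def c_def[abs_def] a n)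
  moreover have nth: "fps_nth (Abs_fps c) = c" by (rule ext) simp
  ultimately obtain U v u1 where U: "finite U" and u1: "u1 \<in> U" "v u1 \<noteq> 0"
    and eq: "\<And>J. (\<Sum>u\<in>U. v u * deriv_term c u J) = 0"
    using assms(5) unfolding D_finite_iff_deriv_term by (metis nth)
  \<comment> \<open>Reading the relation at index \<open>j + L\<close> avoids the zero branch of
    \<open>deriv_term\<close>. The pair \<open>u\<close> then shifts \<open>j\<close> by
    \<open>\<sigma> u\<close>, and \<open>S\<close> bounds all these shifts.\<close>
  define L where "L = (\<Sum>u\<in>U. fst u)"
  define S where "S = L + (\<Sum>u\<in>U. snd u)"
  define \<sigma> where "\<sigma> u = L - fst u + snd u" for u :: "nat \<times> nat"
  have L: "fst u \<le> L" if "u \<in> U" for u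
    unfolding L_def by (rule member_le_sum) (use that U in auto)
  have "snd u \<le> (\<Sum>u\<in>U. snd u)" if "u \<in> U" for u
    by (rule member_le_sum) (use that U in auto)
  then have \<sigma>S: "\<sigma> u \<le> S" if "u \<in> U" for u
    unfolding \<sigma>_def S_def using that by (intro add_mono) auto
  obtain W H where WH: "\<forall>j. W j \<noteq> 0" "\<forall>s\<le>S. H s \<noteq> 0"
    "\<forall>s'\<le>S. \<forall>s<s'. degree (H s) < degree (H s')"
    "\<forall>s\<le>S. \<forall>j. c (j + s) = W j * poly (H s) (q ^ j)"
    using q_binomial_shift_polynomial[OF assms(4) nru assms(2) a(2), of S k M, folded c_def]
    by (elim exE conjE) (rule that)
  note W = WH(1)[rule_format] and H0 = WH(2)[rule_format] and H_mono = WH(3)[rule_format]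
    and H = WH(4)[rule_format]
  define P where "P u = pochhammer [:of_nat (L - fst u) + 1 :: complex, 1:] (snd u)"
    for u :: "nat \<times> nat"
  have deriv_u: "deriv_term c u (j + L) = W j * (poly (P u) (of_nat j) * poly (H (\<sigma> u)) (q ^ j))"
    if "u \<in> U" for u j
  proof -
    have "j + L - fst u = j + (L - fst u)" using L[OF that] by simp
    then show ?thesis
      using L[OF that] H[OF \<sigma>S[OF that], of j]
      by (simp add: deriv_term_def P_def poly_pochhammer \<sigma>_def algebra_simps)
  qed
  have "(\<Sum>u\<in>U. poly (smult (v u) (P u)) (of_nat j) * poly (H (\<sigma> u)) (q ^ j)) = 0" for j
  proof -
    have "W j * (\<Sum>u\<in>U. poly (smult (v u) (P u)) (of_nat j) * poly (H (\<sigma> u)) (q ^ j)) =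
        (\<Sum>u\<in>U. v u * deriv_term c u (j + L))"
      unfolding sum_distrib_left by (rule sum.cong) (simp_all add: deriv_u)
    then show ?thesis using W eq by simp
  qed
  then have coeffs: "(\<Sum>u\<in>U. smult (coeff (H (\<sigma> u)) t) (smult (v u) (P u))) = 0" for t
    by (intro poly_in_index_and_power_eq_0[OF U assms(4) nru])
  \<comment> \<open>Among the pairs with nonzero coefficient, \<open>u0\<close> has the largest
    shift \<open>s\<close> and, among those, the largest derivative order \<open>e\<close>.
    Comparing the power \<open>degree (H s)\<close> of \<open>q ^ j\<close> and then the power
    \<open>e\<close> of \<open>j\<close> isolates it: a smaller shift lowers the degree of
    \<open>H\<close>, a smaller order that of \<open>P\<close>.\<close>
  define X where "X = {u \<in> U. v u \<noteq> 0}"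
  have X: "finite X" "X \<noteq> {}" using U u1 unfolding X_def by (simp, blast)
  define s where "s = Max (\<sigma> ` X)"
  define Y where "Y = {u \<in> X. \<sigma> u = s}"
  have "s \<in> \<sigma> ` X" unfolding s_def using X by (intro Max_in) auto
  then have Y: "finite Y" "Y \<noteq> {}" using X by (auto simp: Y_def)
  define e where "e = Max (snd ` Y)"
  have "e \<in> snd ` Y" unfolding e_def using Y by (intro Max_in) auto
  then obtain u0 where u0: "u0 \<in> Y" "snd u0 = e" by auto
  then have u0': "u0 \<in> U" "v u0 \<noteq> 0" "\<sigma> u0 = s" by (auto simp: X_def Y_def)
  have vanish: "coeff (H (\<sigma> u)) (degree (H s)) * (v u * coeff (P u) e) = 0"
    if "u \<in> U" "u \<noteq> u0" for u
  proof (cases "v u = 0")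
    case False
    then have uX: "u \<in> X" using that by (simp add: X_def)
    then have le: "\<sigma> u \<le> s" unfolding s_def using X by simp
    show ?thesis
    proof (cases "\<sigma> u = s")
      case True
      then have uY: "u \<in> Y" using uX by (simp add: Y_def)
      then have "snd u \<le> e" unfolding e_def using Y by simp
      moreover have "snd u \<noteq> e"
      proof
        assume "snd u = e"
        \<comment> \<open>Shift and order determine the pair, since the subtraction from
          \<open>L\<close> is not truncated.\<close>
        then have "fst u = fst u0"
          using True u0' u0(2) L[OF that(1)] L[OF u0'(1)] by (simp add: \<sigma>_def)
        then show False using \<open>snd u = e\<close> u0(2) that(2) by (simp add: prod_eq_iff)
      qed
      ultimately have "degree (P u) < e"
        unfolding P_def by (intro le_less_trans[OF degree_pochhammer_linear_le]) simp
      then show ?thesis by (simp add: coeff_eq_0)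
    next
      case False
      then have "degree (H (\<sigma> u)) < degree (H s)"
        using le \<sigma>S[OF u0'(1)] u0'(3) by (intro H_mono) auto
      then show ?thesis by (simp add: coeff_eq_0)
    qed
  qed simp
  have "0 = (\<Sum>u\<in>U. coeff (H (\<sigma> u)) (degree (H s)) * (v u * coeff (P u) e))"
    using arg_cong[OF coeffs[of "degree (H s)"], of "\<lambda>p. coeff p e"]
    by (simp add: coeff_sum mult.assoc)
  also have "\<dots> = coeff (H (\<sigma> u0)) (degree (H s)) * (v u0 * coeff (P u0) e)"
    unfolding sum.remove[OF U u0'(1)]
    by (subst sum.neutral[of "U - {u0}"]) (use vanish in blast, simp only: add_0_right)
  also have "\<dots> = lead_coeff (H s) * v u0"
    using u0(2) u0'(3) by (simp add: P_def coeff_pochhammer_linear)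
  finally show False using u0' H0 \<sigma>S[OF u0'(1)] by simp
qed

theorem theorem5:
  fixes n k a b :: nat and q :: complex
  assumes "admissible n k a b"
    and "q \<noteq> 0"
  shows "D_finite (h_series n k a b q) \<longleftrightarrow> root_of_unity q"
proof -
  have "k \<le> n" "0 < b" "b < a" using assms(1) by (auto simp: admissible_def)
  then show ?thesis
    using D_finite_h_series_root_of_unity[of k n b a q]
      root_of_unity_if_D_finite_h_series[of k n b a q] assms(2) by auto
qed

end
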